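(* Let $N\ge 3$, $\omega_1,\dots,\omega_N\in\mathbb{R}$, $\alpha\in\mathbb{R}$ with $\alpha\neq0$, and let $\Gamma(\phi)=\sin\phi$ and $H(u,v)=\alpha+\cos(u-v)$. For small $\varepsilon>0$ consider on $\mathbb{T}^N\times\mathbb{R}^{N\times N}$ the adaptive Kuramoto system $$\dot\theta_i=\omega_i+\frac1N\sum_{j=1}^N a_{ij}\sin(\theta_j-\theta_i),\qquad \varepsilon\,\dot a_{ij}=-a_{ij}+\alpha+\cos(\theta_i-\theta_j),\qquad i,j=1,\dots,N.$$ Let $M_\varepsilon=\{(\theta,A):A=h_\varepsilon(\theta)\}$ be the associated slow manifold and let $$F_i^\varepsilon(\theta)=\omega_i+\frac1N\sum_{j=1}^N h_{\varepsilon,ij}(\theta)\sin(\theta_j-\theta_i),\qquad i=1,\dots,N,$$ be the reduced phase vector field on $M_\varepsilon$. Then for all sufficiently small $\varepsilon>0$, $F^\varepsilon=(F_1^\varepsilon,\dots,F_N^\varepsilon)$ is genuinely nonpairwise, that is, $F^\varepsilon\notin\mathcal{V}_{\mathrm{pair}}$.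
   Context: $\mathbb{T}=\mathbb{R}/2\pi\mathbb{Z}$; $A=(a_{ij})\in\mathbb{R}^{N\times N}$. Pairwise class: a $C^2$ vector field $F=(F_1,\dots,F_N):\mathbb{T}^N\to\mathbb{R}^N$ is pairwise, written $F\in\mathcal{V}_{\mathrm{pair}}$, if for each $i$ there exist functions $G_{ij}\in C^2(\mathbb{T}^2,\mathbb{R})$, $j=1,\dots,N$, with $F_i(\theta)=\sum_{j=1}^N G_{ij}(\theta_i,\theta_j)$ for all $\theta$. Slow manifold: the critical manifold is the compact graph $M_0=\{(\theta,A):A=h_0(\theta)\}$, $h_{0,ij}(\theta)=H(\theta_i,\theta_j)=\alpha+\cos(\theta_i-\theta_j)$; it is normally hyperbolic and attracting (the linearisation of the fast equation in $A$ is $-I_{N^2}$). The associated slow manifold is the family given by Fenichel's theorem: for all sufficiently small $\varepsilon>0$, a map $h_\varepsilon:\mathbb{T}^N\to\mathbb{R}^{N\times N}$ of class $C^3$ whose graph $M_\varepsilon$ is locally invariant under the flow of the system and is $O(\varepsilon)$-close to $M_0$ as $\varepsilon\to0$. *)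

theory Defs
  imports "HOL-Analysis.Analysis"
begin

text \<open>
  The torus \<open>(\<real>/2\<pi>\<int>)\<^sup>N\<close> is represented by its universal cover: functions on the torus are functions
  on \<^typ>\<open>real ^ 'n\<close> that are \<open>2\<pi>\<close>-periodic in every coordinate, and a subset of
  torus times matrices is represented by its preimage in the cover.
  An element of \<^typ>\<open>real ^ 'n ^ 'n\<close> is a matrix \<open>A\<close> with entries \<open>a\<^sub>i\<^sub>j = A $ i $ j\<close>.
\<close>

definition torus_periodic :: "('a::euclidean_space \<Rightarrow> 'b) \<Rightarrow> bool" where
  "torus_periodic f \<longleftrightarrow> (\<forall>x. \<forall>b\<in>Basis. f (x + (2 * pi) *\<^sub>R b) = f x)"

text \<open>
  Class \<open>C\<^sup>k\<close> on the whole space. As the domain is finite-dimensional, the derivative is of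
  class \<open>C\<^sup>k\<close> iff each of the maps \<open>x \<mapsto> Df(x) v\<close> is, which keeps the recursion at a fixed type.
\<close>

primrec C_k :: "nat \<Rightarrow> ('a::euclidean_space \<Rightarrow> 'b::real_normed_vector) \<Rightarrow> bool" where
  "C_k 0 f \<longleftrightarrow> continuous_on UNIV f"
| "C_k (Suc k) f \<longleftrightarrow>
     (\<exists>f'. (\<forall>x. (f has_derivative f' x) (at x)) \<and> (\<forall>v. C_k k (\<lambda>x. f' x v)))"

definition V_pair :: "(real ^ 'n \<Rightarrow> real ^ 'n) set" where
  "V_pair = {F. C_k 2 F \<and> torus_periodic F \<and>
     (\<forall>i. \<exists>G :: 'n \<Rightarrow> real \<times> real \<Rightarrow> real.
        (\<forall>j. C_k 2 (G j) \<and> torus_periodic (G j)) \<and>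
        (\<forall>\<theta>. F \<theta> $ i = (\<Sum>j\<in>UNIV. G j (\<theta> $ i, \<theta> $ j))))}"

definition solution_on :: "('a::real_normed_vector \<Rightarrow> 'a) \<Rightarrow> real set \<Rightarrow> (real \<Rightarrow> 'a) \<Rightarrow> bool" where
  "solution_on X T x \<longleftrightarrow> (\<forall>t\<in>T. (x has_vector_derivative X (x t)) (at t within T))"

text \<open>
  \<open>M\<close> is locally invariant if it has a neighbourhood \<open>V\<close> such that no trajectory starting in \<open>M\<close>
  can leave \<open>M\<close>, forwards or backwards in time, without leaving \<open>V\<close>. (The closed segment from 0 to \<open>\<tau>\<close>
  is \<open>[0, \<tau>]\<close> or \<open>[\<tau>, 0]\<close> according to the sign of \<open>\<tau>\<close>.)
\<close>

definition locally_invariant :: "('a::real_normed_vector \<Rightarrow> 'a) \<Rightarrow> 'a set \<Rightarrow> bool" where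
  "locally_invariant X M \<longleftrightarrow>
     (\<exists>V. open V \<and> M \<subseteq> V \<and>
        (\<forall>\<tau> x. solution_on X (closed_segment 0 \<tau>) x \<and> x 0 \<in> M \<and>
               (\<forall>t\<in>closed_segment 0 \<tau>. x t \<in> V) \<longrightarrow>
               (\<forall>t\<in>closed_segment 0 \<tau>. x t \<in> M)))"

text \<open>Right-hand side of the adaptive Kuramoto system, the fast equation being divided by \<open>\<epsilon>\<close>.\<close>

definition kuramoto_field ::
  "real ^ 'n \<Rightarrow> real \<Rightarrow> real \<Rightarrow> (real ^ 'n) \<times> (real ^ 'n ^ 'n) \<Rightarrow> (real ^ 'n) \<times> (real ^ 'n ^ 'n)" where
  "kuramoto_field \<omega> \<alpha> \<epsilon> = (\<lambda>(\<theta>, A).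
     (\<chi> i. \<omega> $ i + 1 / real CARD('n) * (\<Sum>j\<in>UNIV. A $ i $ j * sin (\<theta> $ j - \<theta> $ i)),
      \<chi> i j. 1 / \<epsilon> * (- A $ i $ j + \<alpha> + cos (\<theta> $ i - \<theta> $ j))))"

definition graph_of :: "('a \<Rightarrow> 'b) \<Rightarrow> ('a \<times> 'b) set" where
  "graph_of h = {(\<theta>, A). A = h \<theta>}"

definition h0 :: "real \<Rightarrow> real ^ 'n \<Rightarrow> real ^ 'n ^ 'n" where
  "h0 \<alpha> \<theta> = (\<chi> i j. \<alpha> + cos (\<theta> $ i - \<theta> $ j))"

text \<open>
  Closeness \<open>O(\<epsilon>)\<close> is that of the graphs, in the Hausdorff distance. Since the graphs are periodic
  in the phases, distances to them in the cover and in the torus agree.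
\<close>

definition slow_manifold ::
  "real ^ 'n \<Rightarrow> real \<Rightarrow> (real \<Rightarrow> real ^ 'n \<Rightarrow> real ^ 'n ^ 'n) \<Rightarrow> bool" where
  "slow_manifold \<omega> \<alpha> h \<longleftrightarrow>
     (\<forall>\<^sub>F \<epsilon> in at_right 0.
        C_k 3 (h \<epsilon>) \<and> torus_periodic (h \<epsilon>) \<and>
        locally_invariant (kuramoto_field \<omega> \<alpha> \<epsilon>) (graph_of (h \<epsilon>))) \<and>
     (\<exists>C. \<forall>\<^sub>F \<epsilon> in at_right 0.
        (\<forall>p\<in>graph_of (h \<epsilon>). infdist p (graph_of (h0 \<alpha>)) \<le> C * \<epsilon>) \<and>
        (\<forall>p\<in>graph_of (h0 \<alpha>). infdist p (graph_of (h \<epsilon>)) \<le> C * \<epsilon>))"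

definition reduced_field ::
  "real ^ 'n \<Rightarrow> (real ^ 'n \<Rightarrow> real ^ 'n ^ 'n) \<Rightarrow> real ^ 'n \<Rightarrow> real ^ 'n" where
  "reduced_field \<omega> h \<theta> =
     (\<chi> i. \<omega> $ i + 1 / real CARD('n) * (\<Sum>j\<in>UNIV. h \<theta> $ i $ j * sin (\<theta> $ j - \<theta> $ i)))"

end

(*
  No trajectory on the slow manifold is needed beyond an arbitrarily short one: local existence and
  local invariance turn the slow manifold into a periodic solution of the transport equation
  h + e Dh.F = h0, where F is the reduced field and h0 the critical manifold. At a maximum of a
  periodic function its derivative vanishes, so a bound on f + e Df.F is a bound on f. Applied to h,
  to h - h0 and to h - h0 - e q with q = -Dh0.F0 (F0 the reduced field of h0), this gives
  h = h0 + e q + O(e^2) uniformly, with no a priori control of Dh as e tends to 0.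
  For a pairwise field the i-th component has vanishing mixed second differences in two phases other
  than the i-th one. The mixed difference of F between the phases 0, pi and 0, pi/2 is
  2 alpha e / N^2 + O(e^2), hence nonzero for small e.
*)
theory Submission
  imports Defs
begin

section \<open>Short-time solutions and the invariance equation of a graph\<close>

text \<open>On a time interval with \<open>L * \<tau> < 1\<close> the Picard integral operator
  contracts the supremum distance by the factor \<open>L * \<tau>\<close>, so Banach's fixed point
  theorem applies directly.\<close>

lemma picard_lipschitz:
  fixes X :: "'a::banach \<Rightarrow> 'a"
  assumes lip: "L-lipschitz_on UNIV X" and "0 < \<tau>" and small: "L * \<tau> < 1"
  shows "\<exists>x. solution_on X {0..\<tau>} x \<and> x 0 = p"
proof -
  \<comment> \<open>Clamping time to \<open>{0..\<tau>}\<close> extends the integral curves to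
    bounded continuous functions on the whole line, which form a complete metric space as a
    type.\<close>
  define c where "c t = max 0 (min \<tau> t)" for t
  define I where "I \<phi> t = p + integral {0..t} (\<lambda>s. X (apply_bcontfun \<phi> s))" for \<phi> and t :: real
  define T where "T \<phi> = Bcontfun (\<lambda>t. I \<phi> (c t))" for \<phi>
  have "L \<ge> 0" using lip by (rule lipschitz_on_nonneg)
  have contX: "continuous_on S (\<lambda>s. X (apply_bcontfun \<phi> s))" for \<phi> and S :: "real set"
    using continuous_on_compose2[OF lipschitz_on_continuous_on[OF lip]
        continuous_on_apply_bcontfun[of S \<phi>]]
    by simp
  have c_in: "c t \<in> {0..\<tau>}" for t
    using \<open>0 < \<tau>\<close> by (auto simp: c_def)
  have contI: "continuous_on {0..\<tau>} (I \<phi>)" for \<phi>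
    unfolding I_def
    by (intro continuous_intros indefinite_integral_continuous_1 integrable_continuous_real contX)
  have "continuous_on UNIV c"
    unfolding c_def by (intro continuous_intros)
  then have contIc: "continuous_on UNIV (\<lambda>t. I \<phi> (c t))" for \<phi>
    using continuous_on_compose2[OF contI] c_in by blast
  have "bounded (I \<phi> ` {0..\<tau>})" for \<phi>
    by (intro compact_imp_bounded compact_continuous_image contI) simp
  then have "bounded (range (\<lambda>t. I \<phi> (c t)))" for \<phi>
    by (rule bounded_subset) (use c_in in blast)
  then have T: "apply_bcontfun (T \<phi>) t = I \<phi> (c t)" for \<phi> t
    unfolding T_def using contIc by (subst Bcontfun_inverse) (auto simp: bcontfun_def)
  have "dist (T \<phi>) (T \<psi>) \<le> (L * \<tau>) * dist \<phi> \<psi>" for \<phi> \<psi>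
  proof (rule dist_bound)
    fix t
    have "norm (X (apply_bcontfun \<phi> s) - X (apply_bcontfun \<psi> s)) \<le> L * dist \<phi> \<psi>" for s
      using lipschitz_onD[OF lip, of "apply_bcontfun \<phi> s" "apply_bcontfun \<psi> s"]
        mult_left_mono[OF dist_bounded[of \<phi> s \<psi>] \<open>L \<ge> 0\<close>]
      by (simp add: dist_norm)
    then have "norm (integral {0..c t} (\<lambda>s. X (apply_bcontfun \<phi> s) - X (apply_bcontfun \<psi> s)))
        \<le> (L * dist \<phi> \<psi>) * (c t - 0)"
      using c_in by (intro integral_bound continuous_intros contX) auto
    also have "\<dots> \<le> (L * dist \<phi> \<psi>) * \<tau>"
      using c_in[of t] \<open>L \<ge> 0\<close> by (intro mult_left_mono) auto
    finally show "dist (apply_bcontfun (T \<phi>) t) (apply_bcontfun (T \<psi>) t) \<le> L * \<tau> * dist \<phi> \<psi>"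
      unfolding T I_def dist_norm
      by (subst (asm) integral_diff) (auto intro!: integrable_continuous_real contX simp: mult_ac)
  qed
  then obtain \<phi> where fp: "T \<phi> = \<phi>"
    using banach_fix_type[of "L * \<tau>" T] small \<open>L \<ge> 0\<close> \<open>0 < \<tau>\<close> by auto
  have \<phi>: "apply_bcontfun \<phi> t = I \<phi> t" if "t \<in> {0..\<tau>}" for t
    using T[of \<phi> t] that by (simp add: fp c_def min_absorb2 max_absorb2)
  have "(apply_bcontfun \<phi> has_vector_derivative X (apply_bcontfun \<phi> t)) (at t within {0..\<tau>})"
    if t: "t \<in> {0..\<tau>}" for t
  proof (rule has_vector_derivative_transform[OF t \<phi>])
    show "(I \<phi> has_vector_derivative X (apply_bcontfun \<phi> t)) (at t within {0..\<tau>})"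
      unfolding I_def
      using has_vector_derivative_add[OF has_vector_derivative_const
          integral_has_vector_derivative[OF contX t]]
      by simp
  qed
  moreover have "apply_bcontfun \<phi> 0 = p"
    using \<phi>[of 0] \<open>0 < \<tau>\<close> by (simp add: I_def)
  ultimately show ?thesis
    unfolding solution_on_def by blast
qed

text \<open>Precomposing \<open>X\<close> with the closest-point projection onto the ball, a map
  with Lipschitz constant 1, makes it globally Lipschitz. A solution of the modified equation starts
  at the centre, so for a short time it stays in the ball, where both fields agree, and in
  \<open>V\<close>.\<close>

lemma local_solution:
  fixes X :: "'a::euclidean_space \<Rightarrow> 'a"
  assumes "L-lipschitz_on (cball p 1) X" and "open V" and "p \<in> V"
  shows "\<exists>\<tau>>0. \<exists>x. solution_on X {0..\<tau>} x \<and> x 0 = p \<and> x ` {0..\<tau>} \<subseteq> V"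
proof -
  define P where "P = closest_point (cball p 1)"
  have P_in: "P x \<in> cball p 1" for x
    unfolding P_def by (intro closest_point_in_set) auto
  have "1-lipschitz_on UNIV P"
    unfolding P_def by (intro lipschitz_onI) (auto intro!: closest_point_lipschitz)
  then have lip: "(L * 1)-lipschitz_on UNIV (\<lambda>x. X (P x))"
    by (rule lipschitz_on_compose2)
      (use lipschitz_on_subset[OF assms(1)] P_in in \<open>auto simp: image_subset_iff\<close>)
  have "L \<ge> 0" using assms(1) by (rule lipschitz_on_nonneg)
  \<comment> \<open>The summand 1 keeps the quotient defined when \<open>L\<close> is 0 and makes
    \<open>L * \<tau>\<close> strictly less than 1.\<close>
  define \<tau> where "\<tau> = 1 / (L + 1)"
  have "\<tau> > 0" "L * 1 * \<tau> < 1" using \<open>L \<ge> 0\<close> by (auto simp: \<tau>_def)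
  from picard_lipschitz[OF lip this] obtain x
    where sol: "solution_on (\<lambda>x. X (P x)) {0..\<tau>} x" and "x 0 = p" by blast
  have "continuous_on {0..\<tau>} x"
    using sol unfolding solution_on_def
    by (auto intro!: has_vector_derivative_continuous simp: continuous_on_eq_continuous_within)
  moreover have "open (V \<inter> ball p 1)" "x 0 \<in> V \<inter> ball p 1"
    using assms \<open>x 0 = p\<close> by auto
  ultimately have "\<forall>\<^sub>F t in at 0 within {0..\<tau>}. x t \<in> V \<inter> ball p 1"
    using \<open>\<tau> > 0\<close> by (intro topological_tendstoD) (auto simp: continuous_on_def)
  then obtain d where d: "d > 0" "\<And>t. t \<in> {0..\<tau>} \<Longrightarrow> t \<noteq> 0 \<Longrightarrow> dist t 0 < d \<Longrightarrow> x t \<in> V \<inter> ball p 1"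
    unfolding eventually_at by blast
  \<comment> \<open>Halving \<open>d\<close> places the closed interval up to
    \<open>\<sigma>\<close> inside the strict bound \<open>dist t 0 < d\<close>.\<close>
  define \<sigma> where "\<sigma> = min \<tau> (d / 2)"
  have "\<sigma> > 0" "\<sigma> \<le> \<tau>" "\<sigma> < d" using d \<open>\<tau> > 0\<close> by (auto simp: \<sigma>_def)
  have in_V: "x t \<in> V \<inter> ball p 1" if "t \<in> {0..\<sigma>}" for t
    using d(2)[of t] that \<open>\<sigma> \<le> \<tau>\<close> \<open>\<sigma> < d\<close> \<open>x 0 \<in> V \<inter> ball p 1\<close> by (cases "t = 0") auto
  have "solution_on X {0..\<sigma>} x"
    unfolding solution_on_def
  proof
    fix t assume t: "t \<in> {0..\<sigma>}"
    then have "(x has_vector_derivative X (P (x t))) (at t within {0..\<tau>})"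
      using sol \<open>\<sigma> \<le> \<tau>\<close> by (auto simp: solution_on_def)
    moreover have "P (x t) = x t"
      using in_V[OF t] unfolding P_def by (intro closest_point_self) auto
    ultimately show "(x has_vector_derivative X (x t)) (at t within {0..\<sigma>})"
      using \<open>\<sigma> \<le> \<tau>\<close> by (auto intro: has_vector_derivative_within_subset)
  qed
  then show ?thesis
    using \<open>\<sigma> > 0\<close> \<open>x 0 = p\<close> in_V by blast
qed

text \<open>A short trajectory from \<open>(u, h u)\<close> stays on the graph, so its second
  component is \<open>h\<close> of its first. Differentiating this identity at time 0 by the chain
  rule gives the equation; one-sided derivatives suffice, being unique at an endpoint of a
  nondegenerate interval.\<close>

lemma invariant_graph_eq:
  fixes X :: "'a::euclidean_space \<times> 'b::euclidean_space \<Rightarrow> 'a \<times> 'b"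
  assumes inv: "locally_invariant X (graph_of h)"
    and "L-lipschitz_on (cball (u, h u) 1) X"
    and h': "(h has_derivative h') (at u)"
  shows "h' (fst (X (u, h u))) = snd (X (u, h u))"
proof -
  obtain V where V: "open V" "graph_of h \<subseteq> V"
    and inv: "\<And>\<tau> x. solution_on X (closed_segment 0 \<tau>) x \<Longrightarrow> x 0 \<in> graph_of h \<Longrightarrow>
      (\<forall>t\<in>closed_segment 0 \<tau>. x t \<in> V) \<Longrightarrow> \<forall>t\<in>closed_segment 0 \<tau>. x t \<in> graph_of h"
    using inv unfolding locally_invariant_def by blast
  have u: "(u, h u) \<in> graph_of h" by (simp add: graph_of_def)
  then obtain \<tau> x where "\<tau> > 0" and sol: "solution_on X {0..\<tau>} x" and x0: "x 0 = (u, h u)"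
    and "x ` {0..\<tau>} \<subseteq> V"
    using local_solution[OF assms(2)] V by blast
  then have on_graph: "x t \<in> graph_of h" if "t \<in> {0..\<tau>}" for t
    using inv[of \<tau> x] u that by (auto simp: closed_segment_eq_real_ivl image_subset_iff)
  have x': "(x has_derivative (\<lambda>t. t *\<^sub>R X (u, h u))) (at 0 within {0..\<tau>})"
    using sol \<open>\<tau> > 0\<close>
    by (simp add: solution_on_def has_vector_derivative_def flip: x0)
  have d1: "((\<lambda>t. fst (x t)) has_derivative (\<lambda>t. t *\<^sub>R fst (X (u, h u)))) (at 0 within {0..\<tau>})"
    using has_derivative_fst[OF x'] by simp
  have d2: "((\<lambda>t. snd (x t)) has_vector_derivative snd (X (u, h u))) (at 0 within {0..\<tau>})"
    using has_derivative_snd[OF x'] by (simp add: has_vector_derivative_def)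
  have "(h has_derivative h') (at (fst (x 0)))"
    using h' by (simp add: x0)
  then have "((\<lambda>t. h (fst (x t))) has_derivative (\<lambda>t. h' (t *\<^sub>R fst (X (u, h u)))))
      (at 0 within {0..\<tau>})"
    using has_derivative_compose[OF d1] by blast
  then have "((\<lambda>t. h (fst (x t))) has_vector_derivative h' (fst (X (u, h u)))) (at 0 within {0..\<tau>})"
    by (simp add: has_vector_derivative_def linear_cmul[OF has_derivative_linear[OF h']])
  then have "((\<lambda>t. snd (x t)) has_vector_derivative h' (fst (X (u, h u)))) (at 0 within {0..\<tau>})"
    by (rule has_vector_derivative_transform[rotated 2])
      (use \<open>\<tau> > 0\<close> on_graph in \<open>auto simp: graph_of_def case_prod_beta\<close>)
  with d2 show ?thesis
    using vector_derivative_unique_within_closed_interval[of 0 \<tau> 0] \<open>\<tau> > 0\<close> by auto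
qed

section \<open>A maximum principle for transport equations on the torus\<close>

lemma torus_periodic_int:
  fixes f :: "'a::euclidean_space \<Rightarrow> 'b"
  assumes "torus_periodic f" and b: "b \<in> Basis"
  shows "f (x + (2 * pi * of_int k) *\<^sub>R b) = f x"
proof -
  have step: "f (y + (2 * pi) *\<^sub>R b) = f y" for y
    using assms by (simp add: torus_periodic_def)
  show ?thesis
  proof (induction k rule: int_induct[where k = 0])
    case (step1 i)
    then show ?case
      using step[of "x + (2 * pi * of_int i) *\<^sub>R b"]
      by (simp add: algebra_simps)
  next
    case (step2 i)
    then show ?case
      using step[of "x + (2 * pi * of_int (i - 1)) *\<^sub>R b"]
      by (simp add: algebra_simps)
  qed simp
qed

text \<open>Every value is attained on the compact cube with sides \<open>{0..2 * pi}\<close>, so a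
  maximum over the cube is a global one.\<close>

lemma torus_periodic_max:
  fixes f :: "'a::euclidean_space \<Rightarrow> real"
  assumes per: "torus_periodic f" and cont: "continuous_on UNIV f"
  shows "\<exists>x. \<forall>y. f y \<le> f x"
proof -
  define K :: "'a set" where "K = cbox 0 (\<Sum>b\<in>Basis. (2 * pi) *\<^sub>R b)"
  have reduce: "\<exists>z\<in>K. f z = f y" for y
  proof -
    define k where "k b = \<lfloor>(y \<bullet> b) / (2 * pi)\<rfloor>" for b
    \<comment> \<open>Periodicity concerns one coordinate at a time, hence the induction over sets
      \<open>B\<close> of coordinates already reduced.\<close>
    have "f (y - (\<Sum>b\<in>B. (2 * pi * of_int (k b)) *\<^sub>R b)) = f y" if "B \<subseteq> Basis" for B
      using finite_subset[OF that finite_Basis] that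
    proof (induction B)
      case (insert b B)
      then show ?case
        using torus_periodic_int[OF per, of b _ "- k b"]
        by (simp add: algebra_simps) (metis diff_diff_eq add.commute)
    qed simp
    moreover have "y - (\<Sum>b\<in>Basis. (2 * pi * of_int (k b)) *\<^sub>R b) \<in> K"
    proof -
      have "of_int (k b) \<le> (y \<bullet> b) / (2 * pi)" "(y \<bullet> b) / (2 * pi) \<le> of_int (k b) + 1" for b
        unfolding k_def by linarith+
      then have "2 * pi * of_int (k b) \<le> y \<bullet> b" "y \<bullet> b \<le> 2 * pi * of_int (k b) + 2 * pi" for b
        by (simp_all add: field_simps)
      then show ?thesis
        by (simp add: K_def mem_box inner_diff_left algebra_simps)
    qed
    ultimately show ?thesis by blast
  qed
  have "compact K" by (simp add: K_def)
  moreover have "K \<noteq> {}" using reduce by blast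
  ultimately obtain x where "\<forall>y\<in>K. f y \<le> f x"
    using continuous_attains_sup[of K f] continuous_on_subset[OF cont] by auto
  then show ?thesis using reduce by metis
qed

text \<open>The term \<open>c * f' x (v x)\<close> is zero at a maximum point of \<open>f\<close>,
  whatever \<open>c\<close> and \<open>v\<close> are. The resulting bound involves neither the size
  of \<open>f'\<close> nor \<open>c\<close>, which makes the later estimates uniform in
  \<epsilon>.\<close>

lemma torus_transport_le:
  fixes f :: "'a::euclidean_space \<Rightarrow> real"
  assumes per: "torus_periodic f"
    and f': "\<And>x. (f has_derivative f' x) (at x)"
    and le: "\<And>x. f x + c * f' x (v x) \<le> B"
  shows "f x \<le> B"
proof -
  have "continuous_on UNIV f"
    using f' by (meson continuous_at_imp_continuous_on has_derivative_continuous)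
  then obtain m where m: "\<And>y. f y \<le> f m"
    using torus_periodic_max[OF per] by blast
  then have "f' m = (\<lambda>_. 0)"
    by (intro has_derivative_local_max[OF f']) simp
  with le[of m] m[of x] show ?thesis by simp
qed

lemma torus_transport_abs_le:
  fixes f :: "'a::euclidean_space \<Rightarrow> real"
  assumes per: "torus_periodic f"
    and f': "\<And>x. (f has_derivative f' x) (at x)"
    and le: "\<And>x. \<bar>f x + c * f' x (v x)\<bar> \<le> B"
  shows "\<bar>f x\<bar> \<le> B"
proof -
  have "f x \<le> B"
    using le by (intro torus_transport_le[OF per f', of c v]) (simp add: abs_le_iff)
  moreover have "- f x \<le> B"
  proof (rule torus_transport_le[where f = "\<lambda>x. - f x" and c = c and v = v])
    show "torus_periodic (\<lambda>x. - f x)" using per by (simp add: torus_periodic_def)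
    show "((\<lambda>x. - f x) has_derivative (\<lambda>w. - f' x w)) (at x)" for x
      by (intro has_derivative_minus f')
    show "- f x + c * - f' x (v x) \<le> B" for x
      using le[of x] by (simp add: abs_le_iff)
  qed
  ultimately show ?thesis by (simp add: abs_le_iff)
qed

section \<open>Lipschitz continuity of the Kuramoto field on bounded sets\<close>

lemma lipschitz_on_mult_bounded:
  fixes f g :: "'a::metric_space \<Rightarrow> real"
  assumes f: "L-lipschitz_on S f" and g: "M-lipschitz_on S g"
    and B: "\<And>x. x \<in> S \<Longrightarrow> \<bar>f x\<bar> \<le> B" and C: "\<And>x. x \<in> S \<Longrightarrow> \<bar>g x\<bar> \<le> C"
  shows "\<exists>K. K-lipschitz_on S (\<lambda>x. f x * g x)"
proof -
  \<comment> \<open>The absolute values keep the constant nonnegative even for empty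
    \<open>S\<close>, where \<open>B\<close> and \<open>C\<close> may be negative.\<close>
  have "(\<bar>B\<bar> * M + \<bar>C\<bar> * L)-lipschitz_on S (\<lambda>x. f x * g x)"
  proof (rule lipschitz_onI)
    fix x y assume xy: "x \<in> S" "y \<in> S"
    have "\<bar>f x * g x - f y * g y\<bar> = \<bar>f x * (g x - g y) + g y * (f x - f y)\<bar>"
      by (simp add: algebra_simps)
    also have "\<dots> \<le> \<bar>f x\<bar> * \<bar>g x - g y\<bar> + \<bar>g y\<bar> * \<bar>f x - f y\<bar>"
      by (metis abs_mult abs_triangle_ineq)
    also have "\<dots> \<le> \<bar>B\<bar> * (M * dist x y) + \<bar>C\<bar> * (L * dist x y)"
      using B[OF xy(1)] C[OF xy(2)] lipschitz_onD[OF f xy] lipschitz_onD[OF g xy]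
      by (intro add_mono mult_mono) (auto simp: dist_real_def)
    finally show "dist (f x * g x) (f y * g y) \<le> (\<bar>B\<bar> * M + \<bar>C\<bar> * L) * dist x y"
      by (simp add: dist_real_def algebra_simps)
  qed (use lipschitz_on_nonneg[OF f] lipschitz_on_nonneg[OF g] in auto)
  then show ?thesis ..
qed

lemma lipschitz_on_sum:
  fixes f :: "'i \<Rightarrow> 'a::metric_space \<Rightarrow> 'b::real_normed_vector"
  assumes "\<And>i. i \<in> I \<Longrightarrow> \<exists>L. L-lipschitz_on S (f i)"
  shows "\<exists>L. L-lipschitz_on S (\<lambda>x. \<Sum>i\<in>I. f i x)"
  using assms
proof (induction I rule: infinite_finite_induct)
  case (insert i I)
  then obtain K L where "K-lipschitz_on S (f i)" "L-lipschitz_on S (\<lambda>x. \<Sum>i\<in>I. f i x)"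
    by blast
  from lipschitz_on_add[OF this] show ?case
    using insert.hyps by auto
qed (auto intro: lipschitz_on_constant)

lemma lipschitz_on_vec:
  fixes f :: "'a::metric_space \<Rightarrow> 'b::metric_space ^ 'n"
  assumes "\<And>i. \<exists>L. L-lipschitz_on S (\<lambda>x. f x $ i)"
  shows "\<exists>L. L-lipschitz_on S f"
proof -
  obtain L where L: "\<And>i. (L i)-lipschitz_on S (\<lambda>x. f x $ i)" using assms by metis
  have "(\<Sum>i\<in>UNIV. L i)-lipschitz_on S f"
  proof (rule lipschitz_onI)
    fix x y assume xy: "x \<in> S" "y \<in> S"
    have "dist (f x) (f y) \<le> (\<Sum>i\<in>UNIV. dist (f x $ i) (f y $ i))"
      unfolding dist_vec_def by (intro L2_set_le_sum) simp
    also have "\<dots> \<le> (\<Sum>i\<in>UNIV. L i * dist x y)"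
      by (intro sum_mono lipschitz_onD[OF L xy])
    finally show "dist (f x) (f y) \<le> (\<Sum>i\<in>UNIV. L i) * dist x y"
      by (simp add: sum_distrib_right)
  qed (auto intro!: sum_nonneg lipschitz_on_nonneg[OF L])
  then show ?thesis ..
qed

lemma sin_lipschitz: "1-lipschitz_on S (sin :: real \<Rightarrow> real)"
  and cos_lipschitz: "1-lipschitz_on S (cos :: real \<Rightarrow> real)"
proof -
  have "norm (sin x - sin y) \<le> 1 * norm (x - y)" for x y :: real
    by (rule field_differentiable_bound[of UNIV _ cos])
      (auto intro!: derivative_eq_intros)
  then show "1-lipschitz_on S (sin :: real \<Rightarrow> real)"
    by (intro lipschitz_onI) (auto simp: dist_real_def)
  have "norm (cos x - cos y) \<le> 1 * norm (x - y)" for x y :: real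
    by (rule field_differentiable_bound[of UNIV _ "\<lambda>x. - sin x"])
      (auto intro!: derivative_eq_intros)
  then show "1-lipschitz_on S (cos :: real \<Rightarrow> real)"
    by (intro lipschitz_onI) (auto simp: dist_real_def)
qed

text \<open>The products of a weight with a sine are the terms for which boundedness of
  \<open>S\<close> matters: it bounds the weights, while the sines are bounded anyway.\<close>

lemma kuramoto_field_lipschitz_on_bounded:
  fixes \<omega> :: "real ^ 'n"
  assumes "bounded S"
  shows "\<exists>L. L-lipschitz_on S (kuramoto_field \<omega> \<alpha> \<epsilon>)"
proof -
  have phase: "1-lipschitz_on S (\<lambda>p. fst p $ i)" for i :: 'n
    by (intro lipschitz_onI) (auto intro!: order_trans[OF dist_vec_nth_le order_trans[OF dist_fst_le]])
  have weight: "1-lipschitz_on S (\<lambda>p. snd p $ i $ j)" for i j :: 'n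
    by (intro lipschitz_onI) (auto intro!: order_trans[OF dist_vec_nth_le order_trans[OF dist_vec_nth_le order_trans[OF dist_snd_le]]])
  obtain B where B: "\<And>p. p \<in> S \<Longrightarrow> norm p \<le> B"
    using assms bounded_iff by blast
  have weight_bound: "\<bar>snd p $ i $ j\<bar> \<le> B" if "p \<in> S" for p and i j :: 'n
  proof -
    have "\<bar>snd p $ i $ j\<bar> \<le> norm (snd p $ i)" by (rule component_le_norm_cart)
    also have "\<dots> \<le> norm (snd p)" by (rule Finite_Cartesian_Product.norm_nth_le)
    also have "\<dots> \<le> norm p" by (metis norm_snd_le prod.collapse)
    finally show ?thesis using B[OF that] by simp
  qed
  have diff: "2-lipschitz_on S (\<lambda>p. fst p $ i - fst p $ j)" for i j :: 'n
    using lipschitz_on_diff[OF phase phase] by simp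
  have sin: "2-lipschitz_on S (\<lambda>p. sin (fst p $ i - fst p $ j))"
    and cos: "2-lipschitz_on S (\<lambda>p. cos (fst p $ i - fst p $ j))" for i j :: 'n
    using lipschitz_on_compose2[OF diff sin_lipschitz] lipschitz_on_compose2[OF diff cos_lipschitz]
    by simp_all
  have "\<exists>L. L-lipschitz_on S (\<lambda>p. snd p $ i $ j * sin (fst p $ j - fst p $ i))" for i j :: 'n
    by (rule lipschitz_on_mult_bounded[OF weight sin weight_bound abs_sin_le_one])
  then have sum: "\<exists>L. L-lipschitz_on S (\<lambda>p. \<Sum>j\<in>UNIV. snd p $ i $ j * sin (fst p $ j - fst p $ i))" for i :: 'n
    by (rule lipschitz_on_sum)
  have slow: "\<exists>L. L-lipschitz_on S (\<lambda>p. \<omega> $ i +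
      1 / real CARD('n) * (\<Sum>j\<in>UNIV. snd p $ i $ j * sin (fst p $ j - fst p $ i)))" for i
  proof -
    obtain L where "L-lipschitz_on S (\<lambda>p. \<Sum>j\<in>UNIV. snd p $ i $ j * sin (fst p $ j - fst p $ i))"
      using sum by blast
    from lipschitz_on_add[OF lipschitz_on_constant lipschitz_on_cmult_real[OF this]]
    show ?thesis by blast
  qed
  have fast: "\<exists>L. L-lipschitz_on S (\<lambda>p. 1 / \<epsilon> * (- snd p $ i $ j + \<alpha> + cos (fst p $ i - fst p $ j)))"
    for i j :: 'n
    using lipschitz_on_cmult_real[OF lipschitz_on_add[OF lipschitz_on_add[OF
        lipschitz_on_minus[OF weight] lipschitz_on_constant] cos]]
    by blast
  have "\<exists>K. K-lipschitz_on S (\<lambda>p. \<chi> i. \<omega> $ i +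
      1 / real CARD('n) * (\<Sum>j\<in>UNIV. snd p $ i $ j * sin (fst p $ j - fst p $ i)))"
    by (intro lipschitz_on_vec) (simp only: vec_lambda_beta slow)
  moreover have "\<exists>L. L-lipschitz_on S
      (\<lambda>p. (\<chi> i j. 1 / \<epsilon> * (- snd p $ i $ j + \<alpha> + cos (fst p $ i - fst p $ j))) :: real ^ 'n ^ 'n)"
    by (intro lipschitz_on_vec) (simp only: vec_lambda_beta fast)
  ultimately obtain K L where "K-lipschitz_on S (\<lambda>p. \<chi> i. \<omega> $ i +
      1 / real CARD('n) * (\<Sum>j\<in>UNIV. snd p $ i $ j * sin (fst p $ j - fst p $ i)))"
    and "L-lipschitz_on S
      (\<lambda>p. (\<chi> i j. 1 / \<epsilon> * (- snd p $ i $ j + \<alpha> + cos (fst p $ i - fst p $ j))) :: real ^ 'n ^ 'n)"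
    by blast
  from lipschitz_on_Pair[OF this] show ?thesis
    unfolding kuramoto_field_def case_prod_beta by blast
qed

section \<open>Periodicity and size of the reduced field\<close>

lemma torus_phase_shift:
  fixes \<theta> b :: "real ^ 'n"
  assumes "b \<in> Basis"
  shows "sin ((\<theta> + (2 * pi) *\<^sub>R b) $ i - (\<theta> + (2 * pi) *\<^sub>R b) $ j) = sin (\<theta> $ i - \<theta> $ j)"
    and "cos ((\<theta> + (2 * pi) *\<^sub>R b) $ i - (\<theta> + (2 * pi) *\<^sub>R b) $ j) = cos (\<theta> $ i - \<theta> $ j)"
proof -
  obtain k where b: "b = axis k 1"
    using assms by (auto simp: Basis_vec_def)
  have per: "sin (u + 2 * pi - v) = sin (u - v)" "cos (u + 2 * pi - v) = cos (u - v)"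
    "sin (u - (v + 2 * pi)) = sin (u - v)" "cos (u - (v + 2 * pi)) = cos (u - v)" for u v :: real
    using sin_periodic[of "u - v"] cos_periodic[of "u - v"]
      sin_periodic[of "u - v - 2 * pi"] cos_periodic[of "u - v - 2 * pi"]
    by (simp_all add: algebra_simps)
  show "sin ((\<theta> + (2 * pi) *\<^sub>R b) $ i - (\<theta> + (2 * pi) *\<^sub>R b) $ j) = sin (\<theta> $ i - \<theta> $ j)"
    and "cos ((\<theta> + (2 * pi) *\<^sub>R b) $ i - (\<theta> + (2 * pi) *\<^sub>R b) $ j) = cos (\<theta> $ i - \<theta> $ j)"
    by (simp_all add: b axis_def per)
qed

lemma abs_mult_sin_le: "\<bar>a * sin x\<bar> \<le> \<bar>a\<bar>" for a x :: real
  by (simp add: abs_mult mult_left_le)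

lemma abs_mean_le:
  fixes a :: "'n::finite \<Rightarrow> real"
  assumes "\<And>j. \<bar>a j\<bar> \<le> K"
  shows "\<bar>1 / real CARD('n) * (\<Sum>j\<in>UNIV. a j)\<bar> \<le> K"
proof -
  have "\<bar>\<Sum>j\<in>UNIV. a j\<bar> \<le> (\<Sum>j\<in>(UNIV :: 'n set). K)"
    using assms by (intro order_trans[OF sum_abs] sum_mono)
  then show ?thesis by (simp add: abs_mult field_simps)
qed

text \<open>The frequencies cancel, and the coupling is a mean of weights times sines, so an
  entrywise bound on the weights passes to the field without a factor depending on the
  dimension.\<close>

lemma reduced_field_diff_le:
  assumes "\<And>j. \<bar>h \<theta> $ i $ j - k \<theta> $ i $ j\<bar> \<le> K"
  shows "\<bar>reduced_field \<omega> h \<theta> $ i - reduced_field \<omega> k \<theta> $ i\<bar> \<le> K"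
proof -
  have "reduced_field \<omega> h \<theta> $ i - reduced_field \<omega> k \<theta> $ i
      = 1 / real CARD('a) * (\<Sum>j\<in>UNIV. (h \<theta> $ i $ j - k \<theta> $ i $ j) * sin (\<theta> $ j - \<theta> $ i))"
    by (simp add: reduced_field_def sum_subtractf left_diff_distrib right_diff_distrib)
  also have "\<bar>\<dots>\<bar> \<le> K"
    by (intro abs_mean_le order_trans[OF abs_mult_sin_le assms])
  finally show ?thesis .
qed

lemma reduced_field_le:
  assumes "\<And>j. \<bar>h \<theta> $ i $ j\<bar> \<le> K"
  shows "\<bar>reduced_field \<omega> h \<theta> $ i\<bar> \<le> norm \<omega> + K"
proof -
  have "\<bar>reduced_field \<omega> h \<theta> $ i - reduced_field \<omega> (\<lambda>_. 0) \<theta> $ i\<bar> \<le> K"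
    using assms by (intro reduced_field_diff_le) simp
  moreover have "reduced_field \<omega> (\<lambda>_. 0) \<theta> $ i = \<omega> $ i"
    by (simp add: reduced_field_def)
  ultimately show ?thesis
    using component_le_norm_cart[of \<omega> i] by linarith
qed

lemma torus_periodic_h0: "torus_periodic (h0 \<alpha>)"
  \<comment> \<open>Componentwise simplification is switched off so that the shifted differences
    keep the shape of \<open>torus_phase_shift\<close>.\<close>
  by (simp add: torus_periodic_def h0_def torus_phase_shift vec_eq_iff
      del: vector_add_component vector_scaleR_component)

lemma torus_periodic_reduced_field:
  assumes "torus_periodic h"
  shows "torus_periodic (reduced_field \<omega> h)"
  using assms
  by (simp add: torus_periodic_def reduced_field_def torus_phase_shift
      del: vector_add_component vector_scaleR_component)

section \<open>First-order expansion of the slow manifold in \<epsilon>\<close>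

text \<open>The derivative of \<open>-h\<^sub>0\<close> along the reduced field of \<open>h\<^sub>0\<close>, i.e. the coefficient of \<open>\<epsilon>\<close> in \<open>h\<^sub>\<epsilon>\<close>.\<close>

definition slow_corr :: "real ^ 'n \<Rightarrow> real \<Rightarrow> real ^ 'n \<Rightarrow> 'n \<Rightarrow> 'n \<Rightarrow> real" where
  "slow_corr \<omega> \<alpha> \<theta> i j = sin (\<theta> $ i - \<theta> $ j) *
     (reduced_field \<omega> (h0 \<alpha>) \<theta> $ i - reduced_field \<omega> (h0 \<alpha>) \<theta> $ j)"

lemma has_derivative_vec_nth [derivative_intros]:
  "(f has_derivative f') F \<Longrightarrow> ((\<lambda>x. f x $ i) has_derivative (\<lambda>v. f' v $ i)) F"
  by (rule bounded_linear.has_derivative[OF bounded_linear_vec_nth])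

text \<open>The formula for the derivative stays hidden: the expansion uses only a bound that is
  uniform in \<theta> and depends on the direction through its largest entry.\<close>

lemma reduced_field_h0_has_derivative:
  fixes \<omega> \<theta> :: "real ^ 'n"
  shows "\<exists>D. ((\<lambda>\<theta>. reduced_field \<omega> (h0 \<alpha>) \<theta> $ i) has_derivative D) (at \<theta>) \<and>
    (\<forall>v W. (\<forall>k. \<bar>v $ k\<bar> \<le> W) \<longrightarrow> \<bar>D v\<bar> \<le> 2 * (\<bar>\<alpha>\<bar> + 2) * W)"
proof -
  define d where "d v j = (\<alpha> + cos (\<theta> $ i - \<theta> $ j)) * (cos (\<theta> $ j - \<theta> $ i) * (v $ j - v $ i)) -
     sin (\<theta> $ i - \<theta> $ j) * (v $ i - v $ j) * sin (\<theta> $ j - \<theta> $ i)" for v :: "real ^ 'n" and j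
  have "((\<lambda>\<theta>. reduced_field \<omega> (h0 \<alpha>) \<theta> $ i) has_derivative
      (\<lambda>v. 1 / real CARD('n) * (\<Sum>j\<in>UNIV. d v j))) (at \<theta>)"
    unfolding reduced_field_def h0_def vec_lambda_beta d_def
    by (auto intro!: derivative_eq_intros ext sum.cong simp: mult_ac)
  \<comment> \<open>Differentiating the sine contributes
    \<open>(\<bar>\<alpha>\<bar> + 1) * 2 * W\<close>, differentiating the weight
    \<open>2 * W\<close>.\<close>
  moreover have "\<bar>1 / real CARD('n) * (\<Sum>j\<in>UNIV. d v j)\<bar> \<le> 2 * (\<bar>\<alpha>\<bar> + 2) * W"
    if v: "\<And>k. \<bar>v $ k\<bar> \<le> W" for v W
  proof (rule abs_mean_le)
    fix j
    have diff: "\<bar>v $ j - v $ i\<bar> \<le> 2 * W" "\<bar>v $ i - v $ j\<bar> \<le> 2 * W"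
      using v[of i] v[of j] by linarith+
    have "\<bar>\<alpha> + cos (\<theta> $ i - \<theta> $ j)\<bar> \<le> \<bar>\<alpha>\<bar> + 1"
      using abs_cos_le_one[of "\<theta> $ i - \<theta> $ j"] by linarith
    then have "\<bar>(\<alpha> + cos (\<theta> $ i - \<theta> $ j)) * (cos (\<theta> $ j - \<theta> $ i) * (v $ j - v $ i))\<bar>
        \<le> (\<bar>\<alpha>\<bar> + 1) * (1 * (2 * W))"
      unfolding abs_mult by (intro mult_mono diff) auto
    moreover have "\<bar>sin (\<theta> $ i - \<theta> $ j) * (v $ i - v $ j) * sin (\<theta> $ j - \<theta> $ i)\<bar>
        \<le> 1 * (2 * W) * 1"
      using v[of i] unfolding abs_mult by (intro mult_mono diff) auto
    ultimately show "\<bar>d v j\<bar> \<le> 2 * (\<bar>\<alpha>\<bar> + 2) * W"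
      unfolding d_def by (simp add: algebra_simps abs_le_iff)
  qed
  ultimately show ?thesis by blast
qed

text \<open>\<open>W\<close> bounds the entries of both reduced fields, since the weights are
  bounded by \<open>\<bar>\<alpha>\<bar> + 1\<close>. In the final constant \<open>4 * W\<close>
  comes from replacing the field of \<open>h\<close> by that of \<open>h0\<close>, and the other two
  summands from the derivative of the correction.\<close>

lemma slow_expansion:
  fixes \<omega> :: "real ^ 'n" and h :: "real ^ 'n \<Rightarrow> real ^ 'n ^ 'n"
  assumes "\<epsilon> > 0" and per: "torus_periodic h"
    and h': "\<And>\<theta>. (h has_derivative h' \<theta>) (at \<theta>)"
    and pde: "\<And>\<theta>. h' \<theta> (reduced_field \<omega> h \<theta>) = (1 / \<epsilon>) *\<^sub>R (h0 \<alpha> \<theta> - h \<theta>)"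
    and W: "W = norm \<omega> + \<bar>\<alpha>\<bar> + 1"
  shows "\<bar>h \<theta> $ i $ j - h0 \<alpha> \<theta> $ i $ j - \<epsilon> * slow_corr \<omega> \<alpha> \<theta> i j\<bar>
    \<le> (4 * W + 4 * W * W + 4 * (\<bar>\<alpha>\<bar> + 2) * W) * \<epsilon>\<^sup>2"
proof -
  let ?F = "reduced_field \<omega> h" and ?Fz = "reduced_field \<omega> (h0 \<alpha>)"
  have nth: "((\<lambda>\<theta>. h \<theta> $ i $ j) has_derivative (\<lambda>v. h' \<theta> v $ i $ j)) (at \<theta>)" for \<theta> i j
    by (intro derivative_intros h')
  have h0': "((\<lambda>\<theta>. h0 \<alpha> \<theta> $ i $ j) has_derivative
      (\<lambda>v. - (sin (\<theta> $ i - \<theta> $ j) * (v $ i - v $ j)))) (at \<theta>)" for \<theta> i j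
    unfolding h0_def vec_lambda_beta by (auto intro!: derivative_eq_intros)
  have pde: "h \<theta> $ i $ j + \<epsilon> * h' \<theta> (?F \<theta>) $ i $ j = h0 \<alpha> \<theta> $ i $ j" for \<theta> i j
    using \<open>\<epsilon> > 0\<close> by (simp add: pde)
  have per_h: "h (x + (2 * pi) *\<^sub>R b) = h x"
    and per_h0: "h0 \<alpha> (x + (2 * pi) *\<^sub>R b) = h0 \<alpha> x"
    and per_F0: "?Fz (x + (2 * pi) *\<^sub>R b) = ?Fz x" if "b \<in> Basis" for x b
    using that per torus_periodic_h0[of \<alpha>] torus_periodic_reduced_field[OF torus_periodic_h0[of \<alpha>], of \<omega>]
    by (auto simp: torus_periodic_def)

  have h0_bound: "\<bar>h0 \<alpha> \<theta> $ i $ j\<bar> \<le> \<bar>\<alpha>\<bar> + 1" for \<theta> :: "real ^ 'n" and i j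
    using abs_cos_le_one[of "\<theta> $ i - \<theta> $ j"] unfolding h0_def vec_lambda_beta by linarith
  have h_bound: "\<bar>h \<theta> $ i $ j\<bar> \<le> \<bar>\<alpha>\<bar> + 1" for \<theta> i j
    by (rule torus_transport_abs_le[OF _ nth, where c = \<epsilon> and v = ?F])
      (simp_all add: torus_periodic_def per_h pde h0_bound)
  have F: "\<bar>?F \<theta> $ i\<bar> \<le> W" and F0: "\<bar>?Fz \<theta> $ i\<bar> \<le> W" for \<theta> i
    using reduced_field_le[of h, OF h_bound, where \<omega> = \<omega>]
      reduced_field_le[of "h0 \<alpha>", OF h0_bound, where \<omega> = \<omega>]
    by (simp_all add: W add.assoc)
  have sin_mult: "\<bar>sin x * y\<bar> \<le> \<bar>y\<bar>" "\<bar>cos x * y\<bar> \<le> \<bar>y\<bar>" for x y :: real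
    by (simp_all add: abs_mult mult_left_le_one_le)

  \<comment> \<open>By \<open>pde\<close>, applying the transport operator to \<open>h - h0\<close>
    leaves only \<epsilon> times the derivative of \<open>- h0\<close> along \<open>?F\<close>; the
    derivative of \<open>h\<close> drops out.\<close>
  have first_order: "\<bar>h \<theta> $ i $ j - h0 \<alpha> \<theta> $ i $ j\<bar> \<le> \<epsilon> * (2 * W)" for \<theta> i j
  proof (rule torus_transport_abs_le[OF _ has_derivative_diff[OF nth h0'], where c = \<epsilon> and v = ?F])
    show "torus_periodic (\<lambda>\<theta>. h \<theta> $ i $ j - h0 \<alpha> \<theta> $ i $ j)"
      by (simp add: torus_periodic_def per_h per_h0)
    fix \<theta>
    have "h \<theta> $ i $ j - h0 \<alpha> \<theta> $ i $ j +
        \<epsilon> * (h' \<theta> (?F \<theta>) $ i $ j - - (sin (\<theta> $ i - \<theta> $ j) * (?F \<theta> $ i - ?F \<theta> $ j)))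
      = \<epsilon> * (sin (\<theta> $ i - \<theta> $ j) * (?F \<theta> $ i - ?F \<theta> $ j))"
      using pde[of \<theta> i j] by (simp add: algebra_simps)
    also have "\<bar>\<dots>\<bar> \<le> \<epsilon> * \<bar>?F \<theta> $ i - ?F \<theta> $ j\<bar>"
      using \<open>\<epsilon> > 0\<close> sin_mult(1) by (simp add: abs_mult[of \<epsilon>])
    also have "\<dots> \<le> \<epsilon> * (2 * W)"
      using F[of \<theta> i] F[of \<theta> j] \<open>\<epsilon> > 0\<close> by (intro mult_left_mono) linarith+
    finally show "\<bar>h \<theta> $ i $ j - h0 \<alpha> \<theta> $ i $ j +
        \<epsilon> * (h' \<theta> (?F \<theta>) $ i $ j - - (sin (\<theta> $ i - \<theta> $ j) * (?F \<theta> $ i - ?F \<theta> $ j)))\<bar> \<le> \<epsilon> * (2 * W)" .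
  qed
  have FF0: "\<bar>?F \<theta> $ i - ?Fz \<theta> $ i\<bar> \<le> \<epsilon> * (2 * W)" for \<theta> i
    by (intro reduced_field_diff_le first_order)

  obtain D where D: "((\<lambda>\<theta>. ?Fz \<theta> $ i) has_derivative D \<theta> i) (at \<theta>)"
    and D_le: "(\<And>k. \<bar>v $ k\<bar> \<le> W) \<Longrightarrow> \<bar>D \<theta> i v\<bar> \<le> 2 * (\<bar>\<alpha>\<bar> + 2) * W" for \<theta> i v W
    using reduced_field_h0_has_derivative by metis
  \<comment> \<open>This is the product rule for \<open>slow_corr\<close>, with \<open>D\<close> the
    derivatives of the components of \<open>?Fz\<close>.\<close>
  define q' where "q' \<theta> v = cos (\<theta> $ i - \<theta> $ j) * ((v $ i - v $ j) * (?Fz \<theta> $ i - ?Fz \<theta> $ j)) +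
    sin (\<theta> $ i - \<theta> $ j) * (D \<theta> i v - D \<theta> j v)" for \<theta> v
  have corr: "((\<lambda>\<theta>. \<epsilon> * slow_corr \<omega> \<alpha> \<theta> i j) has_derivative (\<lambda>v. \<epsilon> * q' \<theta> v)) (at \<theta>)" for \<theta>
  proof -
    have "((\<lambda>\<theta>. sin (\<theta> $ i - \<theta> $ j)) has_derivative
        (\<lambda>v. (v $ i - v $ j) * cos (\<theta> $ i - \<theta> $ j))) (at \<theta>)"
      by (auto intro!: derivative_eq_intros)
    from has_derivative_mult_right[OF has_derivative_mult[OF this has_derivative_diff[OF D[of i \<theta>] D[of j \<theta>]]], of \<epsilon>]
    show ?thesis
      unfolding slow_corr_def q'_def by (simp add: algebra_simps)
  qed
  have q': "\<bar>q' \<theta> (?F \<theta>)\<bar> \<le> 4 * W * W + 4 * (\<bar>\<alpha>\<bar> + 2) * W" for \<theta>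
  proof -
    let ?d = "(?F \<theta> $ i - ?F \<theta> $ j) * (?Fz \<theta> $ i - ?Fz \<theta> $ j)"
    let ?e = "D \<theta> i (?F \<theta>) - D \<theta> j (?F \<theta>)"
    have "\<bar>?d\<bar> \<le> (2 * W) * (2 * W)"
      using F[of \<theta> i] F[of \<theta> j] F0[of \<theta> i] F0[of \<theta> j]
      unfolding abs_mult by (intro mult_mono) linarith+
    moreover have "\<bar>?e\<bar> \<le> 4 * (\<bar>\<alpha>\<bar> + 2) * W"
      using D_le[of "?F \<theta>" W \<theta> i, OF F] D_le[of "?F \<theta>" W \<theta> j, OF F] by linarith
    moreover have "\<bar>q' \<theta> (?F \<theta>)\<bar> \<le> \<bar>?d\<bar> + \<bar>?e\<bar>"
      unfolding q'_def by (intro order_trans[OF abs_triangle_ineq] add_mono sin_mult)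
    ultimately show ?thesis by simp
  qed
  show ?thesis
  proof (rule torus_transport_abs_le[OF _ has_derivative_diff[OF has_derivative_diff[OF nth h0'] corr],
        where c = \<epsilon> and v = ?F])
    show "torus_periodic (\<lambda>\<theta>. h \<theta> $ i $ j - h0 \<alpha> \<theta> $ i $ j - \<epsilon> * slow_corr \<omega> \<alpha> \<theta> i j)"
      by (simp add: torus_periodic_def slow_corr_def per_h per_h0 per_F0 torus_phase_shift
          del: vector_add_component vector_scaleR_component)
    fix \<theta>
    \<comment> \<open>The derivative of \<open>h0\<close> is taken along \<open>?F\<close>, but
      \<open>slow_corr\<close> is built with \<open>?Fz\<close>. The mismatch \<open>?E\<close> is
      itself of order \<epsilon> by \<open>FF0\<close>, so the terms of order \<epsilon> cancel up
      to second order.\<close>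
    let ?E = "(?F \<theta> $ i - ?Fz \<theta> $ i) - (?F \<theta> $ j - ?Fz \<theta> $ j)"
    have "h \<theta> $ i $ j - h0 \<alpha> \<theta> $ i $ j - \<epsilon> * slow_corr \<omega> \<alpha> \<theta> i j +
        \<epsilon> * (h' \<theta> (?F \<theta>) $ i $ j - - (sin (\<theta> $ i - \<theta> $ j) * (?F \<theta> $ i - ?F \<theta> $ j)) - \<epsilon> * q' \<theta> (?F \<theta>))
      = \<epsilon> * (sin (\<theta> $ i - \<theta> $ j) * ?E) - \<epsilon>\<^sup>2 * q' \<theta> (?F \<theta>)"
      using pde[of \<theta> i j] by (simp add: slow_corr_def algebra_simps power2_eq_square)
    also have "\<bar>\<dots>\<bar> \<le> \<epsilon> * \<bar>?E\<bar> + \<epsilon>\<^sup>2 * \<bar>q' \<theta> (?F \<theta>)\<bar>"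
    proof -
      have "\<bar>\<epsilon> * (sin (\<theta> $ i - \<theta> $ j) * ?E)\<bar> \<le> \<epsilon> * \<bar>?E\<bar>"
        using \<open>\<epsilon> > 0\<close> sin_mult(1) by (simp add: abs_mult[of \<epsilon>])
      then show ?thesis
        by (intro order_trans[OF abs_triangle_ineq4]) (simp add: abs_mult)
    qed
    also have "\<dots> \<le> \<epsilon> * (\<epsilon> * (4 * W)) + \<epsilon>\<^sup>2 * (4 * W * W + 4 * (\<bar>\<alpha>\<bar> + 2) * W)"
      using FF0[of \<theta> i] FF0[of \<theta> j] q'[of \<theta>] \<open>\<epsilon> > 0\<close>
      by (intro add_mono mult_left_mono) auto
    finally show "\<bar>h \<theta> $ i $ j - h0 \<alpha> \<theta> $ i $ j - \<epsilon> * slow_corr \<omega> \<alpha> \<theta> i j +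
        \<epsilon> * (h' \<theta> (?F \<theta>) $ i $ j - - (sin (\<theta> $ i - \<theta> $ j) * (?F \<theta> $ i - ?F \<theta> $ j)) - \<epsilon> * q' \<theta> (?F \<theta>))\<bar>
      \<le> (4 * W + 4 * W * W + 4 * (\<bar>\<alpha>\<bar> + 2) * W) * \<epsilon>\<^sup>2"
      by (simp add: algebra_simps power2_eq_square)
  qed
qed

text \<open>On the graph the phase component of the full field is the reduced field and the weight
  component is \<open>(h0 - h) / \<epsilon>\<close>, so this is the invariance equation for the slow
  manifold.\<close>

lemma slow_manifold_pde:
  fixes \<omega> :: "real ^ 'n"
  assumes "locally_invariant (kuramoto_field \<omega> \<alpha> \<epsilon>) (graph_of h)"
    and "(h has_derivative h') (at \<theta>)"
  shows "h' (reduced_field \<omega> h \<theta>) = (1 / \<epsilon>) *\<^sub>R (h0 \<alpha> \<theta> - h \<theta>)"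
proof -
  obtain L where "L-lipschitz_on (cball (\<theta>, h \<theta>) 1) (kuramoto_field \<omega> \<alpha> \<epsilon>)"
    using kuramoto_field_lipschitz_on_bounded[OF bounded_cball] by blast
  moreover have "fst (kuramoto_field \<omega> \<alpha> \<epsilon> (\<theta>, h \<theta>)) = reduced_field \<omega> h \<theta>"
    by (simp add: kuramoto_field_def reduced_field_def)
  moreover have "snd (kuramoto_field \<omega> \<alpha> \<epsilon> (\<theta>, h \<theta>)) = (1 / \<epsilon>) *\<^sub>R (h0 \<alpha> \<theta> - h \<theta>)"
    by (simp add: kuramoto_field_def h0_def vec_eq_iff)
  ultimately show ?thesis
    using invariant_graph_eq[OF assms(1) _ assms(2)] by metis
qed

section \<open>Mixed differences as an obstruction to being pairwise\<close>

text \<open>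
  At these four points \<open>sin\<^sup>2(\<theta>\<^sub>m - \<theta>\<^sub>i)\<close> vanishes unless \<open>m = k\<close>, which leaves a single term of the
  first-order correction to the \<open>i\<close>-th component of the reduced field.
\<close>

definition probe :: "'n::finite \<Rightarrow> 'n \<Rightarrow> real \<Rightarrow> real \<Rightarrow> real ^ 'n" where
  "probe j k x y = (\<chi> l. if l = j then x else if l = k then y else 0)"

definition mixed_diff :: "'n::finite \<Rightarrow> 'n \<Rightarrow> (real ^ 'n \<Rightarrow> real) \<Rightarrow> real" where
  "mixed_diff j k f = f (probe j k pi (pi / 2)) - f (probe j k 0 (pi / 2))
    - f (probe j k pi 0) + f (probe j k 0 0)"

text \<open>The \<open>i\<close>-th phase is 0 at all four points, so each summand depends on at
  most one of the phases \<open>j\<close> and \<open>k\<close> and is cancelled by the alternating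
  signs. The constant \<open>c\<close> accommodates the natural frequency.\<close>

lemma mixed_diff_pairwise:
  assumes "i \<noteq> j" "i \<noteq> k"
    and f: "\<And>\<theta>. f \<theta> = c + (\<Sum>m\<in>UNIV. G m (\<theta> $ i) (\<theta> $ m))"
  shows "mixed_diff j k f = 0"
proof -
  define P where "P = probe j k"
  have "mixed_diff j k f = (\<Sum>m\<in>UNIV. G m (P pi (pi / 2) $ i) (P pi (pi / 2) $ m)
      - G m (P 0 (pi / 2) $ i) (P 0 (pi / 2) $ m) - G m (P pi 0 $ i) (P pi 0 $ m)
      + G m (P 0 0 $ i) (P 0 0 $ m))"
    unfolding mixed_diff_def P_def f by (simp add: sum.distrib sum_subtractf)
  also have "\<dots> = 0"
    using assms(1,2) by (intro sum.neutral) (auto simp: P_def probe_def)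
  finally show ?thesis .
qed

text \<open>Moving phase \<open>j\<close> from 0 to \<open>pi\<close> affects only the summand
  \<open>m = j\<close>. In component \<open>i\<close> its sine is zero at both ends; in component
  \<open>k\<close> the cosine is zero at both ends and the sine goes from -1 to 1, so the sum
  changes by \<open>2 * \<alpha>\<close>.\<close>

lemma reduced_field_h0_probe_diff:
  fixes \<omega> :: "real ^ 'n"
  assumes "distinct [i, j, k]"
  shows "reduced_field \<omega> (h0 \<alpha>) (probe j k pi (pi / 2)) $ i = reduced_field \<omega> (h0 \<alpha>) (probe j k 0 (pi / 2)) $ i"
    and "reduced_field \<omega> (h0 \<alpha>) (probe j k pi (pi / 2)) $ k - reduced_field \<omega> (h0 \<alpha>) (probe j k 0 (pi / 2)) $ k
      = 2 * \<alpha> / real CARD('n)"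
proof -
  let ?P = "\<lambda>x. probe j k x (pi / 2)"
  have "(\<Sum>m\<in>UNIV. h0 \<alpha> (?P pi) $ i $ m * sin (?P pi $ m - ?P pi $ i))
      = (\<Sum>m\<in>UNIV. h0 \<alpha> (?P 0) $ i $ m * sin (?P 0 $ m - ?P 0 $ i))"
    using assms by (intro sum.cong) (auto simp: h0_def probe_def)
  then show "reduced_field \<omega> (h0 \<alpha>) (?P pi) $ i = reduced_field \<omega> (h0 \<alpha>) (?P 0) $ i"
    by (simp add: reduced_field_def)
  have "(\<Sum>m\<in>UNIV. h0 \<alpha> (?P pi) $ k $ m * sin (?P pi $ m - ?P pi $ k))
      - (\<Sum>m\<in>UNIV. h0 \<alpha> (?P 0) $ k $ m * sin (?P 0 $ m - ?P 0 $ k))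
      = (\<Sum>m\<in>UNIV. if m = j then 2 * \<alpha> else 0)"
    unfolding sum_subtractf[symmetric]
    using assms by (intro sum.cong) (auto simp: h0_def probe_def sin_diff cos_diff)
  then show "reduced_field \<omega> (h0 \<alpha>) (?P pi) $ k - reduced_field \<omega> (h0 \<alpha>) (?P 0) $ k
      = 2 * \<alpha> / real CARD('n)"
    by (simp add: reduced_field_def flip: diff_divide_distrib)
qed

text \<open>The summand for \<open>m\<close> is
  \<open>sin\<^sup>2(\<theta>\<^sub>m - \<theta>\<^sub>i)\<close> times component \<open>m\<close>
  minus component \<open>i\<close> of the field of \<open>h0\<close>. The sum vanishes when phase
  \<open>k\<close> is 0 and equals component \<open>k\<close> minus component \<open>i\<close> when
  it is \<open>pi / 2\<close>; the preceding lemma gives its change in phase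
  \<open>j\<close>.\<close>

lemma mixed_diff_slow_corr:
  fixes \<omega> :: "real ^ 'n"
  assumes ijk: "distinct [i, j, k]"
  shows "mixed_diff j k (\<lambda>\<theta>. \<Sum>m\<in>UNIV. slow_corr \<omega> \<alpha> \<theta> i m * sin (\<theta> $ m - \<theta> $ i))
    = 2 * \<alpha> / real CARD('n)"
proof -
  let ?Q = "\<lambda>\<theta>. \<Sum>m\<in>UNIV. slow_corr \<omega> \<alpha> \<theta> i m * sin (\<theta> $ m - \<theta> $ i)"
  have Q0: "?Q (probe j k x 0) = 0" if "sin x = 0" for x
    using ijk that by (intro sum.neutral) (auto simp: probe_def)
  have Q1: "?Q \<theta> = reduced_field \<omega> (h0 \<alpha>) \<theta> $ k - reduced_field \<omega> (h0 \<alpha>) \<theta> $ i"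
    if \<theta>: "\<theta> = probe j k x (pi / 2)" and "sin x = 0" for x \<theta>
  proof -
    have "?Q \<theta> = (\<Sum>m\<in>UNIV. if m = k then
        reduced_field \<omega> (h0 \<alpha>) \<theta> $ k - reduced_field \<omega> (h0 \<alpha>) \<theta> $ i else 0)"
    proof (intro sum.cong refl)
      fix m
      have "\<theta> $ i = 0" "sin (\<theta> $ k) = 1" "m \<noteq> k \<Longrightarrow> sin (\<theta> $ m) = 0"
        using ijk \<open>sin x = 0\<close> by (auto simp: \<theta> probe_def)
      then show "slow_corr \<omega> \<alpha> \<theta> i m * sin (\<theta> $ m - \<theta> $ i) = (if m = k then
          reduced_field \<omega> (h0 \<alpha>) \<theta> $ k - reduced_field \<omega> (h0 \<alpha>) \<theta> $ i else 0)"
        by (simp add: slow_corr_def)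
    qed
    then show ?thesis by simp
  qed
  show ?thesis
    unfolding mixed_diff_def
    using reduced_field_h0_probe_diff[OF ijk, of \<omega> \<alpha>] Q0[of 0] Q0[of pi]
      Q1[OF refl, of 0] Q1[OF refl, of pi]
    by simp
qed

text \<open>If the field were pairwise, the mixed difference of its first-order term would have to
  be absorbed by the remainder, which contributes at most \<open>C * \<epsilon>\<^sup>2\<close> at
  each of four points. The square of the dimension arises from one mean in the field itself and one
  in the correction.\<close>

lemma nonpairwise_of_expansion:
  fixes \<omega> :: "real ^ 'n"
  assumes ijk: "distinct [i, j, k]"
    and exp: "\<And>\<theta> m. \<bar>h \<theta> $ i $ m - h0 \<alpha> \<theta> $ i $ m - \<epsilon> * slow_corr \<omega> \<alpha> \<theta> i m\<bar> \<le> C * \<epsilon>\<^sup>2"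
    and pair: "reduced_field \<omega> h \<in> V_pair"
  shows "\<bar>\<epsilon>\<bar> * (2 * \<bar>\<alpha>\<bar> / (real CARD('n))\<^sup>2) \<le> 4 * C * \<epsilon>\<^sup>2"
proof -
  let ?F = "\<lambda>\<theta>. reduced_field \<omega> h \<theta> $ i" and ?Fz = "\<lambda>\<theta>. reduced_field \<omega> (h0 \<alpha>) \<theta> $ i"
  let ?Q = "\<lambda>\<theta>. \<Sum>m\<in>UNIV. slow_corr \<omega> \<alpha> \<theta> i m * sin (\<theta> $ m - \<theta> $ i)"
  obtain G where G: "\<And>\<theta>. ?F \<theta> = (\<Sum>m\<in>UNIV. G m (\<theta> $ i, \<theta> $ m))"
    using pair unfolding V_pair_def by blast
  have F: "mixed_diff j k ?F = 0"
    by (rule mixed_diff_pairwise[where c = 0 and G = "\<lambda>m u v. G m (u, v)"]) (use ijk in \<open>auto simp: G\<close>)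
  \<comment> \<open>The field of \<open>h0\<close> is explicitly pairwise, so the obstruction first
    appears at order \<epsilon>.\<close>
  have F0: "mixed_diff j k ?Fz = 0"
    by (rule mixed_diff_pairwise[where c = "\<omega> $ i" and
          G = "\<lambda>m u v. 1 / real CARD('n) * ((\<alpha> + cos (u - v)) * sin (v - u))"])
      (use ijk in \<open>auto simp: reduced_field_def h0_def sum_distrib_left\<close>)
  define R where "R \<theta> = ?F \<theta> - ?Fz \<theta> - \<epsilon> / real CARD('n) * ?Q \<theta>" for \<theta>
  have R: "\<bar>R \<theta>\<bar> \<le> C * \<epsilon>\<^sup>2" for \<theta>
  proof -
    have "R \<theta> = 1 / real CARD('n) * (\<Sum>m\<in>UNIV.
        (h \<theta> $ i $ m - h0 \<alpha> \<theta> $ i $ m - \<epsilon> * slow_corr \<omega> \<alpha> \<theta> i m) * sin (\<theta> $ m - \<theta> $ i))"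
      unfolding R_def reduced_field_def
      by (simp add: left_diff_distrib right_diff_distrib diff_divide_distrib sum_subtractf sum_distrib_left mult.assoc)
    also have "\<bar>\<dots>\<bar> \<le> C * \<epsilon>\<^sup>2"
      by (intro abs_mean_le order_trans[OF abs_mult_sin_le exp])
    finally show ?thesis .
  qed
  have "mixed_diff j k R = mixed_diff j k ?F - mixed_diff j k ?Fz - \<epsilon> / real CARD('n) * mixed_diff j k ?Q"
    unfolding mixed_diff_def R_def by (simp add: algebra_simps)
  then have "\<bar>mixed_diff j k R\<bar> = \<bar>\<epsilon>\<bar> * (2 * \<bar>\<alpha>\<bar> / (real CARD('n))\<^sup>2)"
    unfolding F F0 mixed_diff_slow_corr[OF ijk] by (simp add: abs_mult power2_eq_square)
  moreover have "\<bar>mixed_diff j k R\<bar> \<le> 4 * (C * \<epsilon>\<^sup>2)"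
    unfolding mixed_diff_def
    using R[of "probe j k pi (pi / 2)"] R[of "probe j k 0 (pi / 2)"] R[of "probe j k pi 0"] R[of "probe j k 0 0"]
    by linarith
  ultimately show ?thesis by simp
qed

theorem corollary4p6:
  fixes \<omega> :: "real ^ 'n" and \<alpha> :: real
    and h :: "real \<Rightarrow> real ^ 'n \<Rightarrow> real ^ 'n ^ 'n"
  assumes "CARD('n) \<ge> 3" and "\<alpha> \<noteq> 0"
    and "slow_manifold \<omega> \<alpha> h"
  shows "\<forall>\<^sub>F \<epsilon> in at_right 0. reduced_field \<omega> (h \<epsilon>) \<notin> V_pair"
proof -
  \<comment> \<open>The mixed difference requires two phases besides the \<open>i\<close>-th one,
    hence at least three oscillators.\<close>
  obtain A :: "'n set" where "card A = 3"
    using obtain_subset_with_card_n[OF assms(1)] by blast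
  then obtain i j k :: 'n where ijk: "distinct [i, j, k]"
    by (auto simp: card_3_iff)
  define W where "W = norm \<omega> + \<bar>\<alpha>\<bar> + 1"
  define C where "C = 4 * W + 4 * W * W + 4 * (\<bar>\<alpha>\<bar> + 2) * W"
  have "C > 0"
    unfolding C_def W_def by (intro add_pos_nonneg add_nonneg_pos mult_pos_pos mult_nonneg_nonneg) auto
  define c where "c = 2 * \<bar>\<alpha>\<bar> / (real CARD('n))\<^sup>2"
  have "c > 0" using assms(2) by (simp add: c_def)
  have "\<forall>\<^sub>F \<epsilon> in at_right 0. C_k 3 (h \<epsilon>) \<and> torus_periodic (h \<epsilon>) \<and>
      locally_invariant (kuramoto_field \<omega> \<alpha> \<epsilon>) (graph_of (h \<epsilon>))"
    using assms(3) by (simp add: slow_manifold_def)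
  \<comment> \<open>Below this threshold \<open>4 * C * \<epsilon> < c\<close>, contradicting the
    inequality for a pairwise field after division by \<epsilon>.\<close>
  moreover have "\<forall>\<^sub>F \<epsilon> in at_right 0. \<epsilon> \<in> {0<..<c / (4 * C)}"
    using \<open>c > 0\<close> \<open>C > 0\<close> by (intro eventually_at_right_real) simp
  ultimately show ?thesis
  proof eventually_elim
    case (elim \<epsilon>)
    then have "\<epsilon> > 0" by simp
    obtain h' where h': "\<And>\<theta>. (h \<epsilon> has_derivative h' \<theta>) (at \<theta>)"
      using elim by (auto simp: numeral_3_eq_3)
    have pde: "h' \<theta> (reduced_field \<omega> (h \<epsilon>) \<theta>) = (1 / \<epsilon>) *\<^sub>R (h0 \<alpha> \<theta> - h \<epsilon> \<theta>)" for \<theta>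
      using elim h' by (blast intro: slow_manifold_pde)
    show ?case
    proof
      assume "reduced_field \<omega> (h \<epsilon>) \<in> V_pair"
      moreover have "\<bar>h \<epsilon> \<theta> $ i $ m - h0 \<alpha> \<theta> $ i $ m - \<epsilon> * slow_corr \<omega> \<alpha> \<theta> i m\<bar> \<le> C * \<epsilon>\<^sup>2"
        for \<theta> m
        using elim unfolding C_def by (intro slow_expansion[OF \<open>\<epsilon> > 0\<close> _ h' pde W_def]) blast
      ultimately have "\<bar>\<epsilon>\<bar> * c \<le> 4 * C * \<epsilon>\<^sup>2"
        unfolding c_def by (intro nonpairwise_of_expansion[OF ijk])
      then have "\<epsilon> * c \<le> \<epsilon> * (4 * C * \<epsilon>)"
        using \<open>\<epsilon> > 0\<close> by (simp add: power2_eq_square algebra_simps)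
      then have "c \<le> 4 * C * \<epsilon>"
        using \<open>\<epsilon> > 0\<close> by (simp only: mult_le_cancel_left_pos)
      then show False
        using elim \<open>C > 0\<close> by (simp add: field_simps)
    qed
  qed
qed

end
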